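(* For every integer $n\ge 0$, $a(3n+2)\equiv 0 \pmod 3$, where $a(m)$ denotes the number of cubic partitions of $m$.
   Context: For an integer $m\ge 0$, $a(m)$ (the number of cubic partitions of $m$) is the number of partitions of $m$ in which every even part may carry one of two labels (colours), with $a(0)=1$. Equivalently, the integers $a(m)$ are defined by the generating function $$\sum_{m=0}^{\infty}a(m)x^{m}=\prod_{i=1}^{\infty}\frac{1}{(1-x^{i})(1-x^{2i})},\qquad |x|<1.$$ *)

theory Defs
  imports "HOL-Number_Theory.Cong" "HOL-Library.Multiset"
begin

text \<open>
  A coloured part is a pair \<open>(i, c)\<close> of a size \<open>i\<close> and a label \<open>c\<close>. Every positive \<open>i\<close> may carry
  the label \<open>False\<close>; only an even \<open>i\<close> may carry the second label \<open>True\<close>. Order being irrelevant,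
  a cubic partition is a finite multiset of such parts.
\<close>

definition cubic_partitions :: "nat \<Rightarrow> (nat \<times> bool) multiset set" where
  "cubic_partitions m =
     {P. (\<forall>(i, c)\<in>set_mset P. i > 0 \<and> (c \<longrightarrow> even i)) \<and> (\<Sum>(i, c)\<in>#P. i) = m}"

definition num_cubic_partitions :: "nat \<Rightarrow> nat" where
  "num_cubic_partitions m = card (cubic_partitions m)"

text \<open>
  Since \<^const>\<open>card\<close> is \<open>0\<close> on infinite sets, finiteness is needed for
  \<^const>\<open>num_cubic_partitions\<close> to be the intended count.
\<close>

lemma finite_cubic_partitions: "finite (cubic_partitions m)"
proof -
  let ?A = "{..m} \<times> (UNIV :: bool set)"
  have "cubic_partitions m \<subseteq> mset ` {xs. set xs \<subseteq> ?A \<and> length xs \<le> m}"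
  proof
    fix P assume P: "P \<in> cubic_partitions m"
    obtain xs where xs: "P = mset xs" by (metis ex_mset)
    have "(\<Sum>(i, c)\<in>#P. i) = sum_list (map fst xs)"
      unfolding xs by (induction xs) auto
    then have sum: "sum_list (map fst xs) = m"
      using P by (simp add: cubic_partitions_def)
    have pos: "\<forall>x\<in>set xs. 1 \<le> fst x"
      using P by (fastforce simp: cubic_partitions_def xs)
    have "set xs \<subseteq> ?A"
    proof
      fix x assume "x \<in> set xs"
      then have "fst x \<le> m"
        using member_le_sum_list[of "fst x" "map fst xs"] sum by simp
      then show "x \<in> ?A" by (cases x) simp
    qed
    moreover have "length xs \<le> sum_list (map fst xs)"
      using pos by (induction xs) auto
    ultimately show "P \<in> mset ` {xs. set xs \<subseteq> ?A \<and> length xs \<le> m}"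
      using xs sum by blast
  qed
  moreover have "finite {xs. set xs \<subseteq> ?A \<and> length xs \<le> m}"
    by (rule finite_lists_length_le) simp
  ultimately show ?thesis
    by (meson finite_imageI finite_subset)
qed

lemma num_cubic_partitions_0: "num_cubic_partitions 0 = 1"
proof -
  have "P = {#}" if "P \<in> cubic_partitions 0" for P
  proof (cases P)
    case (add x Q)
    then show ?thesis
      using that by (cases x) (simp add: cubic_partitions_def)
  qed simp
  moreover have "{#} \<in> cubic_partitions 0"
    by (simp add: cubic_partitions_def)
  ultimately have "cubic_partitions 0 = {{#}}" by blast
  then show ?thesis by (simp add: num_cubic_partitions_def)
qed

end

theory Submission
  imports Defs "HOL-Computational_Algebra.Formal_Power_Series"
begin

text \<open>
  Write \<open>E\<^sub>k = \<Prod>i. (1 - x\<^bsup>ki\<^esup>)\<close>. Modulo 3 we have \<open>E\<^sub>2\<^sup>3 = E\<^sub>6\<close>, so the generating function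
  \<open>1 / (E\<^sub>1 E\<^sub>2) = (E\<^sub>2\<^sup>2 / E\<^sub>1) / E\<^sub>2\<^sup>3\<close> is congruent to \<open>(E\<^sub>2\<^sup>2 / E\<^sub>1) / E\<^sub>6\<close>. By Gauss, \<open>E\<^sub>2\<^sup>2 / E\<^sub>1\<close> is the
  sum of \<open>x\<^bsup>s(s+1)/2\<^esup>\<close>, and a triangular number is never 2 modulo 3. Gauss's identity is obtained
  from Shanks's finite form of it; infinite products are avoided by bounding the part sizes.
\<close>

unbundle fps_syntax

section \<open>Shanks's finite form of Gauss's identity\<close>

text \<open>Induction on \<open>n\<close>: the termwise differences of the left sides for
  \<open>n + 1\<close> and \<open>n\<close> telescope. Supplying inverses \<open>h i\<close> instead
  of dividing lets the identity apply to integer power series.\<close>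

lemma Shanks_identity:
  fixes x :: "'a :: comm_ring_1"
  assumes h: "\<And>i. h i * (1 - x ^ (2 * i + 1)) = 1"
  defines "Q \<equiv> \<lambda>s n. \<Prod>i=s..<n. (1 - x ^ (2 * i + 2)) * h i"
  shows "(\<Sum>s<n. Q s n * x ^ (s * (2 * n + 1))) = (\<Sum>s<2 * n. x ^ (s * (s + 1) div 2))"
proof (induction n)
  case 0
  then show ?case by simp
next
  case (Suc n)
  define y where "y = x ^ (2 * n + 1)"
  have pow1: "x ^ (s * (2 * n + 1)) = y ^ s" for s
    by (metis y_def power_mult mult.commute)
  have pow2: "x ^ (s * (2 * Suc n + 1)) = y ^ s * x ^ (2 * s)" for s
    by (simp add: pow1[symmetric] power_add[symmetric] algebra_simps)
  have Q_Suc: "Q s (Suc n) = Q s n * ((1 - y * x) * h n)" if "s \<le> n" for s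
    using that by (simp add: Q_def y_def mult_ac)
  have hn: "h n * (1 - y) = 1"
    using h[of n] by (simp add: y_def)
  define D where "D s = Q s (Suc n) * x ^ (s * (2 * Suc n + 1)) - Q s n * x ^ (s * (2 * n + 1))" for s
  \<comment> \<open>\<open>T\<close> is the closed form of the partial sums of \<open>D\<close>. At
    \<open>s = n\<close> its last factor is \<open>1 - y\<close>, which \<open>h n\<close> cancels,
    leaving a pure power of \<open>y\<close>.\<close>
  define T where "T s = h n * Q s n * y ^ Suc s * (1 - x ^ (2 * s + 1))" for s
  have D: "D s = h n * Q s n * y ^ s * (y * (1 - x ^ (2 * s + 1)) - (1 - x ^ (2 * s)))"
    if "s \<le> n" for s
  proof -
    \<comment> \<open>The coefficient 1 of the subtracted term is written as
      \<open>h n * (1 - y)\<close>, so that \<open>h n\<close> factors out.\<close>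
    have "D s = Q s n * y ^ s * (h n * (1 - y * x) * x ^ (2 * s) - h n * (1 - y))"
      unfolding D_def pow1 pow2 Q_Suc[OF that] hn by (simp add: algebra_simps)
    then show ?thesis by (simp add: algebra_simps)
  qed
  have telescope: "(\<Sum>s\<le>m. D s) = T m" if "m \<le> n" for m
    using that
  proof (induction m)
    case 0
    then show ?case by (simp add: D T_def)
  next
    case (Suc m)
    have "Q m n = (1 - x ^ (2 * m + 2)) * h m * Q (Suc m) n"
      using Suc.prems by (simp add: Q_def prod.atLeast_Suc_lessThan)
    \<comment> \<open>Peeling off the lowest factor of \<open>Q m n\<close> brings in
      \<open>h m\<close>, which cancels the last factor of \<open>T m\<close>; \<open>T m\<close>
      and \<open>D (Suc m)\<close> then share the factor \<open>Q (Suc m) n\<close>.\<close>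
    then have "T m = h n * Q (Suc m) n * y ^ Suc m * (1 - x ^ (2 * Suc m))
        * (h m * (1 - x ^ (2 * m + 1)))"
      by (simp only: T_def mult_ac mult_Suc_right) simp
    then have Tm: "T m = h n * Q (Suc m) n * y ^ Suc m * (1 - x ^ (2 * Suc m))"
      by (simp only: h mult_1_right)
    have "(\<Sum>s\<le>Suc m. D s) = T m + D (Suc m)"
      using Suc by simp
    also have "\<dots> = h n * Q (Suc m) n * y ^ Suc (Suc m) * (1 - x ^ (2 * Suc m + 1))"
      unfolding Tm D[OF Suc.prems] by (simp add: algebra_simps)
    also have "\<dots> = T (Suc m)" by (simp add: T_def)
    finally show ?case .
  qed
  have "Q n n = 1" by (simp add: Q_def)
  have "T n = y ^ Suc n"
  proof -
    have "T n = h n * (1 - y) * y ^ Suc n"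
      unfolding T_def y_def[symmetric] \<open>Q n n = 1\<close> by (simp add: mult_ac)
    then show ?thesis by (simp only: hn mult_1_left)
  qed
  \<comment> \<open>The sum for \<open>n\<close> lacks the index \<open>s = n\<close>, whose term is
    \<open>y ^ n\<close>. This and \<open>T n = y ^ Suc n\<close> are the two new triangular powers,
    for \<open>s = 2 * n\<close> and \<open>s = 2 * n + 1\<close>.\<close>
  have "(\<Sum>s<Suc n. Q s (Suc n) * x ^ (s * (2 * Suc n + 1)))
      = (\<Sum>s\<le>n. D s) + (\<Sum>s<n. Q s n * x ^ (s * (2 * n + 1))) + y ^ n"
    by (simp only: D_def sum_subtractf lessThan_Suc_atMost)
       (simp add: lessThan_Suc_atMost[symmetric] \<open>Q n n = 1\<close> pow1[simplified])
  also have "\<dots> = (\<Sum>s<2 * n. x ^ (s * (s + 1) div 2)) + y ^ n + y ^ Suc n"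
    unfolding telescope[OF order_refl] \<open>T n = y ^ Suc n\<close> Suc.IH by (simp only: add_ac)
  also have "y ^ n = x ^ (2 * n * (2 * n + 1) div 2)"
    by (simp add: pow1[symmetric] mult_ac)
  also have "y ^ Suc n = x ^ (Suc (2 * n) * (Suc (2 * n) + 1) div 2)"
  proof -
    have "Suc (2 * n) * (Suc (2 * n) + 1) div 2 = Suc n * (2 * n + 1)"
      by (simp add: algebra_simps)
    then show ?thesis by (simp only: pow1)
  qed
  finally show ?case by simp
qed

text \<open>Otherwise s(s+1), twice the triangular number, would be 1 modulo 3, but it is always 0
  or 2.\<close>

lemma triangular_mod_3: "s * (s + 1) div 2 mod 3 \<noteq> (2 :: nat)"
proof
  define t where "t = s * (s + 1) div 2"
  assume "s * (s + 1) div 2 mod 3 = 2"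
  then have "2 * t mod 3 = 1" unfolding t_def[symmetric] by presburger
  moreover have "2 * t = s * (s + 1)" by (simp add: t_def)
  ultimately have "(s mod 3) * ((s + 1) mod 3) mod 3 = 1"
    by (simp only: mod_mult_eq)
  moreover have "s mod 3 = 0 \<or> s mod 3 = 1 \<or> s mod 3 = 2" by linarith
  ultimately show False by (auto simp: mod_Suc)
qed

section \<open>Geometric series\<close>

text \<open>The series 1 / (1 - x^k) for k > 0. Explicit coefficients keep it over the integers and
  show its support.\<close>

definition geom :: "nat \<Rightarrow> int fps" where
  "geom k = Abs_fps (\<lambda>n. if k dvd n then 1 else 0)"

lemma geom_mult:
  assumes "k > 0"
  shows "geom k * (1 - fps_X ^ k) = 1"
proof (rule fps_ext)
  fix n
  show "(geom k * (1 - fps_X ^ k)) $ n = 1 $ n"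
    using assms dvd_minus_self[of k n]
    by (auto simp: geom_def right_diff_distrib fps_X_power_mult_right_nth dest: nat_dvd_not_less)
qed

text \<open>In Shanks's identity at \<open>fps_X\<close>, the terms with s \<ge> 1 start at degree
  2n + 1 or later. Up to degree 2n the product, which is the term s = 0, thus agrees with a sum of
  triangular powers.\<close>

lemma Gauss_coeff_eq_0:
  fixes n j :: nat
  assumes "j \<le> 2 * n" "j mod 3 = 2"
  shows "(\<Prod>i<n. (1 - fps_X ^ (2 * i + 2)) * geom (2 * i + 1)) $ j = 0"
proof -
  define Q where "Q s = (\<Prod>i=s..<n. (1 - fps_X ^ (2 * i + 2)) * geom (2 * i + 1))" for s
  have "n > 0" using assms by (cases n) auto
  then have split: "{..<n} = insert 0 {1..<n}" by auto
  have "(Q s * fps_X ^ (s * (2 * n + 1))) $ j = 0" if "s \<in> {1..<n}" for s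
  proof -
    have "j < 1 * (2 * n + 1)" using assms by simp
    also have "\<dots> \<le> s * (2 * n + 1)" using that by (intro mult_le_mono1) simp
    finally show ?thesis by (simp add: fps_X_power_mult_right_nth)
  qed
  then have "(\<Sum>s<n. Q s * fps_X ^ (s * (2 * n + 1))) $ j = Q 0 $ j"
    unfolding split by (simp add: fps_sum_nth)
  moreover have "(\<Sum>s<n. Q s * fps_X ^ (s * (2 * n + 1)))
      = (\<Sum>s<2 * n. fps_X ^ (s * (s + 1) div 2))"
    unfolding Q_def by (rule Shanks_identity) (rule geom_mult, simp)
  moreover have "(\<Sum>s<2 * n. fps_X ^ (s * (s + 1) div 2) :: int fps) $ j = 0"
    using triangular_mod_3 assms by (auto simp: fps_sum_nth intro!: sum.neutral)
  ultimately show ?thesis by (simp add: Q_def lessThan_atLeast0)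
qed

text \<open>Modulo 3, such a series is a series in x^3.\<close>

definition mod3_supported :: "int fps \<Rightarrow> bool" where
  "mod3_supported f \<longleftrightarrow> (\<forall>n. \<not> 3 dvd n \<longrightarrow> 3 dvd f $ n)"

lemma mod3_supported_mult:
  assumes "mod3_supported f" "mod3_supported g"
  shows "mod3_supported (f * g)"
  unfolding mod3_supported_def
proof (intro allI impI)
  fix n :: nat assume "\<not> 3 dvd n"
  then have "\<not> 3 dvd i \<or> \<not> 3 dvd n - i" if "i \<le> n" for i
    using that by (metis dvd_add le_add_diff_inverse)
  then show "3 dvd (f * g) $ n"
    using assms unfolding fps_mult_nth mod3_supported_def
    by (intro dvd_sum) (metis atLeastAtMost_iff dvd_mult dvd_mult2)
qed

lemma mod3_supported_prod:
  assumes "\<And>i. i \<in> A \<Longrightarrow> mod3_supported (f i)"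
  shows "mod3_supported (\<Prod>i\<in>A. f i)"
  using assms
  by (induction A rule: infinite_finite_induct)
     (auto simp: mod3_supported_mult, auto simp: mod3_supported_def)

text \<open>Cubing is additive modulo 3, so \<open>geom k ^ 3\<close> is congruent to
  \<open>geom (3 * k)\<close>.\<close>

lemma mod3_supported_geom_cube:
  assumes "k > 0"
  shows "mod3_supported (geom k ^ 3)"
proof -
  define e where "e = (1 - fps_X ^ k :: int fps)"
  \<comment> \<open>With z = x^k, this is z - z^2, from 1 - z^3 = (1 - z)^3 + 3(z - z^2).\<close>
  define w where "w = (fps_X ^ k - fps_X ^ k * fps_X ^ k :: int fps)"
  have e: "geom k * e = 1"
    unfolding e_def by (rule geom_mult) fact
  have e3: "geom (3 * k) * (e ^ 3 + 3 * w) = 1"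
  proof -
    have "(1 - fps_X ^ (3 * k) :: int fps) = e ^ 3 + 3 * w"
      unfolding e_def w_def
      by (simp add: power_mult mult.commute[of 3 k] power3_eq_cube algebra_simps)
    then show ?thesis using geom_mult[of "3 * k"] assms by simp
  qed
  have "geom k ^ 3 = geom k ^ 3 * (geom (3 * k) * (e ^ 3 + 3 * w))"
    by (simp add: e3)
  also have "\<dots> = (geom k * e) ^ 3 * geom (3 * k) + 3 * (geom k ^ 3 * geom (3 * k) * w)"
    by (simp add: power_mult_distrib algebra_simps)
  finally have "geom k ^ 3 = geom (3 * k) + 3 * (geom k ^ 3 * geom (3 * k) * w)"
    by (simp add: e)
  then have "(geom k ^ 3) $ n = geom (3 * k) $ n + 3 * (geom k ^ 3 * geom (3 * k) * w) $ n" for n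
    by (metis fps_add_nth fps_mult_left_const_nth numeral_fps_const)
  moreover have "geom (3 * k) $ n = 0" if "\<not> 3 dvd n" for n
    using that by (auto simp: geom_def dest: dvd_mult_left)
  ultimately show ?thesis by (simp add: mod3_supported_def)
qed

section \<open>Counting multisets by weight\<close>

definition weighted_msets :: "('a \<Rightarrow> nat) \<Rightarrow> 'a set \<Rightarrow> nat \<Rightarrow> 'a multiset set" where
  "weighted_msets w A m = {P. set_mset P \<subseteq> A \<and> (\<Sum>a\<in>#P. w a) = m}"

text \<open>Either \<open>a\<close> does not occur, or one copy of it is removed. Further copies may
  remain, so \<open>insert a A\<close> recurs on the right; for generating functions this is F = G +
  x^(w a) F, where F belongs to \<open>insert a A\<close> and G to \<open>A\<close>.\<close>

lemma weighted_msets_insert: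
  "weighted_msets w (insert a A) m = weighted_msets w A m \<union>
     (if w a \<le> m then add_mset a ` weighted_msets w (insert a A) (m - w a) else {})"
  (is "?L = ?R")
proof
  show "?L \<subseteq> ?R"
  proof
    fix P assume P: "P \<in> ?L"
    show "P \<in> ?R"
    proof (cases "a \<in># P")
      case True
      then obtain P' where "P = add_mset a P'" by (metis multi_member_split)
      then show ?thesis using P by (auto simp: weighted_msets_def)
    qed (use P in \<open>auto simp: weighted_msets_def\<close>)
  qed
  show "?R \<subseteq> ?L" by (auto simp: weighted_msets_def)
qed

lemma finite_weighted_msets:
  assumes "finite A" "\<And>a. a \<in> A \<Longrightarrow> w a > 0"
  shows "finite (weighted_msets w A m)"
  using assms
proof (induction A arbitrary: m rule: finite_induct)
  case empty
  have "weighted_msets w {} m \<subseteq> {{#}}" by (auto simp: weighted_msets_def)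
  then show ?case by (rule finite_subset) simp
next
  case (insert a A)
  show ?case
  proof (induction m rule: less_induct)
    case (less m)
    have "finite (weighted_msets w (insert a A) (m - w a))" if "w a \<le> m"
      using that insert.prems[of a] by (intro less) simp
    then show ?case
      using insert by (subst weighted_msets_insert) simp
  qed
qed

lemma weighted_msets_gf:
  assumes "finite A" "\<And>a. a \<in> A \<Longrightarrow> w a > 0"
  shows "Abs_fps (\<lambda>m. int (card (weighted_msets w A m))) = (\<Prod>a\<in>A. geom (w a))"
  using assms
proof (induction A rule: finite_induct)
  case empty
  have "weighted_msets w {} m = (if m = 0 then {{#}} else {})" for m
    by (auto simp: weighted_msets_def)
  then show ?case by (simp add: fps_eq_iff)
next
  case (insert a A)
  define F where "F B = Abs_fps (\<lambda>m. int (card (weighted_msets w B m)))" for B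
  have "F (insert a A) = F A + F (insert a A) * fps_X ^ w a"
  proof (rule fps_ext)
    fix m
    have fin: "finite (weighted_msets w A m)" "finite (weighted_msets w (insert a A) k)" for k
      using insert by (auto intro!: finite_weighted_msets)
    have "weighted_msets w A m \<inter> add_mset a ` X = {}" for X
      using insert.hyps by (auto simp: weighted_msets_def)
    then have "card (weighted_msets w (insert a A) m) = card (weighted_msets w A m)
        + (if w a \<le> m then card (weighted_msets w (insert a A) (m - w a)) else 0)"
      using fin by (subst weighted_msets_insert) (simp add: card_Un_disjoint card_image inj_on_def)
    then show "F (insert a A) $ m = (F A + F (insert a A) * fps_X ^ w a) $ m"
      by (simp add: F_def fps_X_power_mult_right_nth)
  qed
  then have "F (insert a A) * (1 - fps_X ^ w a) = F A"
    by (simp add: algebra_simps)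
  then have "F (insert a A) * (geom (w a) * (1 - fps_X ^ w a)) = geom (w a) * F A"
    by (simp only: mult_ac)
  then have "F (insert a A) = geom (w a) * F A"
    using geom_mult[of "w a"] insert.prems by simp
  then show ?case
    using insert by (simp add: F_def)
qed

section \<open>Cubic partitions\<close>

text \<open>No part exceeds m \<le> 2n, so finitely many coloured parts suffice and the generating
  function becomes a finite product.\<close>

lemma cubic_partitions_bounded:
  assumes "m \<le> 2 * n"
  shows "cubic_partitions m = weighted_msets fst
    ((\<lambda>i. (i + 1, False)) ` {..<2 * n} \<union> (\<lambda>i. (2 * i + 2, True)) ` {..<n}) m"
    (is "_ = weighted_msets _ ?A _")
proof -
  have A: "x \<in> ?A \<longleftrightarrow> fst x > 0 \<and> (snd x \<longrightarrow> even (fst x))"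
    if "fst x \<le> 2 * n" for x
  proof
    assume R: "fst x > 0 \<and> (snd x \<longrightarrow> even (fst x))"
    show "x \<in> ?A"
    proof (cases "snd x")
      case True
      then obtain k where "fst x = 2 * k" using R by auto
      then have "x = (2 * (k - 1) + 2, True)" "k - 1 < n"
        using R True that by (auto simp: prod_eq_iff)
      then show ?thesis by blast
    next
      case False
      then have "x = ((fst x - 1) + 1, False)" "fst x - 1 < 2 * n"
        using R that by (auto simp: prod_eq_iff)
      then show ?thesis by blast
    qed
  qed auto
  have le: "fst x \<le> 2 * n" if "x \<in># P" "(\<Sum>x\<in>#P. fst x) = m" for x and P :: "(nat \<times> bool) multiset"
    using that assms by (auto dest!: multi_member_split)
  have "P \<in> cubic_partitions m \<longleftrightarrow> P \<in> weighted_msets fst ?A m" for P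
  proof (cases "(\<Sum>x\<in>#P. fst x) = m")
    case True
    then have "(\<forall>x\<in>#P. fst x > 0 \<and> (snd x \<longrightarrow> even (fst x))) \<longleftrightarrow> (\<forall>x\<in>#P. x \<in> ?A)"
      using A le by (intro ball_cong) (simp_all only:)
    then show ?thesis
      by (simp only: cubic_partitions_def weighted_msets_def case_prod_beta'
          mem_Collect_eq subset_iff Ball_def True)
  qed (simp add: cubic_partitions_def weighted_msets_def case_prod_beta')
  then show ?thesis by blast
qed

lemma cubic_partitions_coeff:
  assumes "m \<le> 2 * n"
  shows "int (num_cubic_partitions m) =
    ((\<Prod>i<n. (1 - fps_X ^ (2 * i + 2)) * geom (2 * i + 1)) * (\<Prod>i<n. geom (2 * i + 2) ^ 3)) $ m"
proof -
  let ?B = "(\<lambda>i. (i + 1, False)) ` {..<2 * n}" and ?C = "(\<lambda>i. (2 * i + 2, True)) ` {..<n}"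
  have "(\<Prod>a\<in>?B \<union> ?C. geom (fst a)) = (\<Prod>a\<in>?B. geom (fst a)) * (\<Prod>a\<in>?C. geom (fst a))"
    by (rule prod.union_disjoint) auto
  also have "\<dots> = (\<Prod>i<2 * n. geom (i + 1)) * (\<Prod>i<n. geom (2 * i + 2))"
    by (subst (1 2) prod.reindex) (auto simp: inj_on_def)
  also have "(\<Prod>i<2 * n. geom (i + 1)) = (\<Prod>i<n. geom (2 * i + 1) * geom (2 * i + 2))"
    by (induction n) (auto simp: mult_ac)
  \<comment> \<open>Each even size contributes two geometric factors. Inserting 1 as a third one
    times its inverse completes the cube and leaves the numerator of Gauss's product.\<close>
  also have "\<dots> * (\<Prod>i<n. geom (2 * i + 2))
      = (\<Prod>i<n. (geom (2 * i + 2) * (1 - fps_X ^ (2 * i + 2)))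
          * (geom (2 * i + 1) * geom (2 * i + 2) * geom (2 * i + 2)))"
    by (subst geom_mult) (simp_all add: prod.distrib)
  also have "\<dots> = (\<Prod>i<n. (1 - fps_X ^ (2 * i + 2)) * geom (2 * i + 1)) * (\<Prod>i<n. geom (2 * i + 2) ^ 3)"
    by (simp only: prod.distrib[symmetric] power3_eq_cube mult_ac)
  finally have "(\<Prod>a\<in>?B \<union> ?C. geom (fst a)) = \<dots>" .
  moreover have "Abs_fps (\<lambda>m. int (card (weighted_msets fst (?B \<union> ?C) m)))
      = (\<Prod>a\<in>?B \<union> ?C. geom (fst a))"
    by (rule weighted_msets_gf) auto
  ultimately have "Abs_fps (\<lambda>m. int (card (weighted_msets fst (?B \<union> ?C) m)))
      = (\<Prod>i<n. (1 - fps_X ^ (2 * i + 2)) * geom (2 * i + 1)) * (\<Prod>i<n. geom (2 * i + 2) ^ 3)"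
    by (simp only:)
  from arg_cong[OF this, of "\<lambda>f. f $ m"] show ?thesis
    unfolding num_cubic_partitions_def cubic_partitions_bounded[OF assms] by (simp only: fps_nth_Abs_fps)
qed

theorem theorem1p1:
  fixes n :: nat
  shows "[num_cubic_partitions (3 * n + 2) = 0] (mod 3)"
proof -
  define m where "m = 3 * n + 2"
  define f where "f = (\<Prod>i<m. (1 - fps_X ^ (2 * i + 2)) * geom (2 * i + 1))"
  define g where "g = (\<Prod>i<m. geom (2 * i + 2) ^ 3)"
  have g: "mod3_supported g"
    unfolding g_def by (intro mod3_supported_prod mod3_supported_geom_cube) simp
  \<comment> \<open>As m is 2 modulo 3, either m - j is not a multiple of 3 and the coefficient of
    \<open>g\<close> is divisible by 3, or j is 2 modulo 3 and that of \<open>f\<close>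
    vanishes.\<close>
  have "3 dvd f $ j * g $ (m - j)" if "j \<le> m" for j
  proof (cases "3 dvd m - j")
    case True
    then have "j mod 3 = 2"
      using that unfolding m_def by presburger
    then have "f $ j = 0"
      unfolding f_def using that by (intro Gauss_coeff_eq_0) auto
    then show ?thesis by simp
  next
    case False
    then show ?thesis using g by (simp add: mod3_supported_def)
  qed
  then have "3 dvd (f * g) $ m"
    unfolding fps_mult_nth by (intro dvd_sum) simp
  also have "(f * g) $ m = int (num_cubic_partitions m)"
    unfolding f_def g_def by (rule cubic_partitions_coeff[symmetric]) simp
  finally have "3 dvd num_cubic_partitions m"
    by presburger
  then show ?thesis
    by (simp add: m_def cong_0_iff)
qed

end
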